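(* Let $\theta=p/q\in(0,1]$, where $p,q\in\mathbb{N}$ and $\gcd(p,q)=1$. Let $(a_n)_{n=1}^\infty=\mathcal{G}(\theta)$. Then $$\left(\theta-\sum_{n=1}^{\ell}\frac{1}{a_n}\right)^{-1}\in\mathbb{N},$$ where $\ell$ is the smallest nonnegative integer such that $p$ divides $q+\ell$. As a result, $$a_{n+1}=a_n^2-a_n+1\quad\text{for all } n\geqslant \ell+1.$$
   Context: $\mathbb{N}$ is the set of positive integers. For $\theta\in(0,1]$ let $G(\theta)=\lfloor 1/\theta\rfloor+1$. The greedy algorithm $\mathcal{G}$ produces the sequence $\mathcal{G}(\theta)=(a_n)_{n=1}^\infty$ of positive integers defined by $a_1=G(\theta)$ and $a_m=G\left(\theta-\sum_{n=1}^{m-1}1/a_n\right)$ for $m\geqslant 2$. An empty sum is $0$. *)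

theory Defs
  imports Complex_Main
begin

definition G :: "real \<Rightarrow> nat" where
  "G \<theta> = nat \<lfloor>1 / \<theta>\<rfloor> + 1"

text \<open>
  Sequences are indexed from 1; the value at index 0 is irrelevant.
  The case \<open>m = 1\<close> is the initial value \<open>G \<theta>\<close>, because the sum is then empty.
\<close>

function greedy :: "real \<Rightarrow> nat \<Rightarrow> nat" where
  "greedy \<theta> m = G (\<theta> - (\<Sum>n\<in>{1..<m}. 1 / real (greedy \<theta> n)))"
  by auto
termination
  by (relation "measure snd") auto

declare greedy.simps [simp del]

end

theory Submission
  imports Defs
begin

text \<open>
  Write the current remainder as an unreduced fraction \<open>p / q\<close>. One greedy step replaces the
  numerator \<open>p\<close> by the least residue \<open>p - q mod p\<close> of \<open>-q\<close>, up to choosing \<open>p\<close> in place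
  of \<open>0\<close>. So numerators strictly decrease until \<open>p\<close> divides \<open>q\<close>, that is, until the
  remainder is a unit fraction, and from then on it stays one. Unless \<open>\<ell> = 0\<close>, the first
  step produces the numerator \<open>\<ell>\<close>, so \<open>\<ell> - 1\<close> further steps suffice. A unit remainder \<open>1 / m\<close>
  is followed by \<open>1 / (m * (m + 1))\<close>, which is the claimed recurrence.
\<close>

definition greedy_step :: "real \<Rightarrow> real" where
  "greedy_step x = x - 1 / real (G x)"

text \<open>Trades the recursion over all earlier terms for iteration of one map on the
  remainder.\<close>

lemma greedy_remainder:
  "\<theta> - (\<Sum>n=1..k. 1 / real (greedy \<theta> n)) = (greedy_step ^^ k) \<theta>"
proof (induction k)
  case 0
  then show ?case by simp
next
  case (Suc k)
  have "greedy \<theta> (Suc k) = G ((greedy_step ^^ k) \<theta>)"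
    unfolding greedy.simps [of \<theta> "Suc k"] atLeastLessThanSuc_atLeastAtMost Suc.IH ..
  with Suc.IH show ?case
    by (simp add: greedy_step_def [of "(greedy_step ^^ k) \<theta>"])
qed

lemma greedy_Suc: "greedy \<theta> (Suc k) = G ((greedy_step ^^ k) \<theta>)"
  unfolding greedy.simps [of \<theta> "Suc k"] atLeastLessThanSuc_atLeastAtMost greedy_remainder ..

lemma G_fraction: "G (real p / real q) = q div p + 1"
  by (simp add: G_def floor_divide_of_nat_eq)

text \<open>Division with remainder gives \<open>p * (q div p + 1) - q = p - q mod p\<close>. The
  result is left unreduced so that numerators can be compared.\<close>

lemma greedy_step_fraction:
  assumes "p \<ge> 1" "q \<ge> 1"
  shows "greedy_step (real p / real q) = real (p - q mod p) / real (q * (q div p + 1))"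
proof -
  have "q = p * (q div p) + q mod p" "q mod p \<le> p"
    using assms by (simp_all add: less_imp_le)
  then have "real (p - q mod p) = real p * real (q div p + 1) - real q"
    by (simp add: of_nat_diff algebra_simps flip: of_nat_mult of_nat_add)
  then show ?thesis
    unfolding greedy_step_def G_fraction using assms
    by (simp add: diff_frac_eq del: of_nat_Suc of_nat_add mult_Suc_right)
qed

lemma greedy_step_unit_fraction:
  assumes "m \<ge> 1"
  shows "greedy_step (1 / real m) = 1 / real (m * (m + 1))"
  using greedy_step_fraction [of 1 m] assms by simp

text \<open>The disjunction is the invariant: if \<open>p dvd q\<close>, the numerator stays
  \<open>p\<close> and divides the new denominator; otherwise it drops by at least 1. For
  \<open>k = 0\<close> the bound forces \<open>p = 1\<close>.\<close>

lemma unit_fraction_after_steps: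
  assumes "p \<ge> 1" "q \<ge> 1" "p dvd q \<or> p \<le> Suc k"
  shows "\<exists>m\<ge>1. (greedy_step ^^ k) (real p / real q) = 1 / real m"
  using assms
proof (induction k arbitrary: p q)
  case 0
  then have "p dvd q" by (auto simp: le_Suc_eq)
  with 0 show ?case by (auto elim!: dvdE)
next
  case (Suc k)
  let ?p = "p - q mod p" and ?q = "q * (q div p + 1)"
  have "q mod p < p"
    using Suc.prems by simp
  then have "?p \<ge> 1" by simp
  moreover have "?q \<ge> 1"
    using Suc.prems by simp
  moreover have "?p dvd ?q \<or> ?p \<le> Suc k"
    using Suc.prems by (cases "p dvd q") (auto simp: dvd_eq_mod_eq_0)
  ultimately have "\<exists>m\<ge>1. (greedy_step ^^ k) (real ?p / real ?q) = 1 / real m"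
    by (rule Suc.IH)
  then show ?case
    using Suc.prems by (simp add: funpow_Suc_right greedy_step_fraction del: funpow.simps)
qed

lemma unit_fraction_after_dvd:
  assumes "p \<ge> 1" "q \<ge> 1" "p dvd q + l"
  shows "\<exists>m\<ge>1. (greedy_step ^^ l) (real p / real q) = 1 / real m"
proof (cases "p dvd q")
  case True
  with assms show ?thesis by (intro unit_fraction_after_steps) auto
next
  case False
  let ?p = "p - q mod p" and ?q = "q * (q div p + 1)"
  from False assms obtain k where l: "l = Suc k" by (cases l) auto
  have "q mod p < p"
    using assms by simp
  then have "?p \<ge> 1" by simp
  moreover have "?q \<ge> 1"
    using assms by simp
  moreover have "?p \<le> Suc k"
  proof -
    \<comment> \<open>This sum is positive since \<open>l > 0\<close>, so divisibility bounds
      \<open>p\<close> by it.\<close>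
    have "p dvd q mod p + l"
      using assms(3) by (simp add: dvd_eq_mod_eq_0 mod_add_left_eq)
    then have "p \<le> q mod p + l"
      using l by (intro dvd_imp_le) auto
    then show ?thesis using l by simp
  qed
  ultimately have "\<exists>m\<ge>1. (greedy_step ^^ k) (real ?p / real ?q) = 1 / real m"
    by (intro unit_fraction_after_steps) auto
  then show ?thesis
    using assms l by (simp add: funpow_Suc_right greedy_step_fraction del: funpow.simps)
qed

lemma unit_fraction_persists:
  assumes "m \<ge> 1" "(greedy_step ^^ l) \<theta> = 1 / real m" "l \<le> n"
  shows "\<exists>m\<ge>1. (greedy_step ^^ n) \<theta> = 1 / real m"
  using assms(3)
proof (induction n rule: dec_induct)
  case base
  with assms show ?case by blast
next
  case (step n)
  then obtain m where "m \<ge> 1" "(greedy_step ^^ n) \<theta> = 1 / real m" by blast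
  then show ?case
    using greedy_step_unit_fraction [of m] by (intro exI [of _ "m * (m + 1)"]) simp
qed

text \<open>With \<open>a = m + 1\<close>, \<open>m * (m + 1) + 1\<close> is a^2 - a + 1.\<close>

lemma greedy_recurrence:
  assumes "m \<ge> 1" "(greedy_step ^^ k) \<theta> = 1 / real m"
  shows "int (greedy \<theta> (Suc (Suc k))) =
    (int (greedy \<theta> (Suc k)))\<^sup>2 - int (greedy \<theta> (Suc k)) + 1"
proof -
  have "greedy \<theta> (Suc k) = m + 1"
    using G_fraction [of 1 m] assms by (simp add: greedy_Suc)
  moreover have "greedy \<theta> (Suc (Suc k)) = m * (m + 1) + 1"
    using G_fraction [of 1 "m * (m + 1)"] greedy_step_unit_fraction [of m] assms
    by (simp add: greedy_Suc)
  ultimately show ?thesis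
    by (simp add: power2_eq_square algebra_simps)
qed

theorem proposition1p6:
  fixes \<theta> :: real and p q l :: nat and a :: "nat \<Rightarrow> nat"
  assumes "0 < \<theta>" and "\<theta> \<le> 1"
    and "\<theta> = real p / real q"
    and "p \<ge> 1" and "q \<ge> 1" and "gcd p q = 1"
    and "a = greedy \<theta>"
    and "l = (LEAST k. p dvd q + k)"
  shows "inverse (\<theta> - (\<Sum>n=1..l. 1 / real (a n))) \<in> real ` {1..}
    \<and> (\<forall>n\<ge>l + 1. int (a (n + 1)) = (int (a n))\<^sup>2 - int (a n) + 1)"
proof -
  \<comment> \<open>A witness that the set under \<open>LEAST\<close> is nonempty.\<close>
  have "q + q * (p - 1) = p * q"
    using assms(4) by (cases p) auto
  then have "p dvd q + q * (p - 1)" by simp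
  then have "p dvd q + l"
    unfolding assms(8) by (rule LeastI)
  then obtain m where m: "m \<ge> 1" "(greedy_step ^^ l) \<theta> = 1 / real m"
    using unit_fraction_after_dvd assms(3-5) by blast
  have "inverse (\<theta> - (\<Sum>n=1..l. 1 / real (a n))) = real m"
    unfolding assms(7) greedy_remainder m(2) by simp
  moreover have "int (a (n + 1)) = (int (a n))\<^sup>2 - int (a n) + 1" if "n \<ge> l + 1" for n
  proof -
    \<comment> \<open>Term \<open>n\<close> is chosen from the remainder after \<open>n - 1\<close>
      steps, hence the shift.\<close>
    from that obtain k where k: "n = Suc k" "l \<le> k" by (cases n) auto
    with unit_fraction_persists [OF m] greedy_recurrence show ?thesis
      unfolding assms(7) by auto
  qed
  ultimately show ?thesis
    using m(1) by auto
qed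

end
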